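(* Let $n>3$. The dynamics group $G_{201}$ of Wolfram rule $201$ on the circular graph with $n$ vertices is a subdirect product of Lucas groups and Fibonacci groups. In particular, \[ G_{201}\subset \mathrm{LG}_n\times\prod_{\ell=1}^{n}\prod_{m=3}^{n-2}\mathrm{FG}_m^{(\ell)}, \] where the embedding is given by restricting the action of $G_{201}$ to the orbits defining the factors.
   Context: Indices are taken modulo $n$. For $1\le i\le n$ let $F_i\colon\mathbb{F}_2^n\to\mathbb{F}_2^n$ (the local update function of Wolfram rule $201$) be the map that changes $y_i$ to $1-y_i$ if $y_{i-1}=y_{i+1}=0$, leaves $y_i$ unchanged otherwise, and leaves all other coordinates unchanged. Each $F_i$ is a bijection, every state in $\mathbb{F}_2^n$ is periodic, and the dynamics group $G_{201}$ is the group of permutations of $\mathbb{F}_2^n$ generated by $F_1,\dots,F_n$. The Lucas group $\mathrm{LG}_n$ is the permutation group obtained by restricting $G_{201}$ to the orbit of the all-zero state. For $3\le m\le n-2$ and $1\le\ell\le n$, the Fibonacci group $\mathrm{FG}_m^{(\ell)}$ is the permutation group obtained by restricting $G_{201}$ to the orbit of the state $\mathbf{y}$ having a single $0$-block of length $m$ starting at position $\ell$, i.e. $y_\ell=y_{\ell+1}=\dots=y_{\ell+m-1}=0$ (indices mod $n$) and all other coordinates equal to $1$. A group $G$ is a subdirect product of groups $G_1,\dots,G_r$ if it embeds in $G_1\times\cdots\times G_r$ so that the projection to each factor is onto. Empty products are trivial. *)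

theory Defs
  imports "HOL-Algebra.Algebra" "HOL-Library.Z2"
begin

(* A state is an extensional function on the residues {..<n} modulo n. Positions are arbitrary
   naturals i, and position i refers to the coordinate i mod n, so that {1..n} runs through all
   coordinates exactly once, with n denoting the coordinate 0. *)
definition states :: "nat \<Rightarrow> (nat \<Rightarrow> bit) set" where
  "states n = ({..<n} \<rightarrow>\<^sub>E UNIV)"

(* (i + n - 1) mod n is i - 1 modulo n, avoiding truncated subtraction. *)
definition rule201 :: "nat \<Rightarrow> nat \<Rightarrow> (nat \<Rightarrow> bit) \<Rightarrow> (nat \<Rightarrow> bit)" where
  "rule201 n i = (\<lambda>y \<in> states n.
     if y ((i + n - 1) mod n) = 0 \<and> y ((i + 1) mod n) = 0
     then y (i mod n := 1 - y (i mod n)) else y)"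

(* The generators do lie in the symmetric group BijGroup (states n), see rule201_in_BijGroup, so
   the intersection with the carrier inside subgroup_generated discards nothing. *)
definition G201 :: "nat \<Rightarrow> ((nat \<Rightarrow> bit) \<Rightarrow> (nat \<Rightarrow> bit)) monoid" where
  "G201 n = subgroup_generated (BijGroup (states n)) (rule201 n ` {1..n})"

definition orbit201 :: "nat \<Rightarrow> (nat \<Rightarrow> bit) \<Rightarrow> (nat \<Rightarrow> bit) set" where
  "orbit201 n y = orbit (G201 n) (\<lambda>g. g) y"

(* The permutation group that a permutation group G induces on a G-invariant set A. *)
definition restriction_group :: "('a \<Rightarrow> 'a) monoid \<Rightarrow> 'a set \<Rightarrow> ('a \<Rightarrow> 'a) monoid" where
  "restriction_group G A = (BijGroup A)\<lparr>carrier := (\<lambda>g. restrict g A) ` carrier G\<rparr>"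

definition zero_state :: "nat \<Rightarrow> (nat \<Rightarrow> bit)" where
  "zero_state n = (\<lambda>j \<in> {..<n}. 0)"

definition block_state :: "nat \<Rightarrow> nat \<Rightarrow> nat \<Rightarrow> (nat \<Rightarrow> bit)" where
  "block_state n m l = (\<lambda>j \<in> {..<n}. if \<exists>k<m. j = (l + k) mod n then 0 else 1)"

definition lucas_orbit :: "nat \<Rightarrow> (nat \<Rightarrow> bit) set" where
  "lucas_orbit n = orbit201 n (zero_state n)"

definition fib_orbit :: "nat \<Rightarrow> nat \<Rightarrow> nat \<Rightarrow> (nat \<Rightarrow> bit) set" where
  "fib_orbit n m l = orbit201 n (block_state n m l)"

definition LG :: "nat \<Rightarrow> ((nat \<Rightarrow> bit) \<Rightarrow> (nat \<Rightarrow> bit)) monoid" where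
  "LG n = restriction_group (G201 n) (lucas_orbit n)"

definition FG :: "nat \<Rightarrow> nat \<Rightarrow> nat \<Rightarrow> ((nat \<Rightarrow> bit) \<Rightarrow> (nat \<Rightarrow> bit)) monoid" where
  "FG n m l = restriction_group (G201 n) (fib_orbit n m l)"

definition subdirect_product ::
  "('a, 'c) monoid_scheme \<Rightarrow> 'i set \<Rightarrow> ('i \<Rightarrow> ('b, 'd) monoid_scheme) \<Rightarrow> bool" where
  "subdirect_product G I H \<longleftrightarrow> group G \<and> (\<forall>i\<in>I. group (H i)) \<and>
     (\<exists>\<phi> \<in> mon G (product_group I H). \<forall>i\<in>I. (\<lambda>g. \<phi> g i) ` carrier G = carrier (H i))"

(* The family consisting of the Lucas group, at index None, and the Fibonacci groups FG n m l,
   at index Some (l, m). *)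
definition factor_index :: "nat \<Rightarrow> (nat \<times> nat) option set" where
  "factor_index n = insert None (Some ` ({1..n} \<times> {3..n - 2}))"

definition factor_group ::
  "nat \<Rightarrow> (nat \<times> nat) option \<Rightarrow> ((nat \<Rightarrow> bit) \<Rightarrow> (nat \<Rightarrow> bit)) monoid" where
  "factor_group n = case_option (LG n) (\<lambda>(l, m). FG n m l)"

definition orbit_restrictions :: "nat \<Rightarrow> ((nat \<Rightarrow> bit) \<Rightarrow> (nat \<Rightarrow> bit)) \<Rightarrow>
    ((nat \<Rightarrow> bit) \<Rightarrow> (nat \<Rightarrow> bit)) \<times> (nat \<Rightarrow> nat \<Rightarrow> (nat \<Rightarrow> bit) \<Rightarrow> (nat \<Rightarrow> bit))" where
  "orbit_restrictions n g =
     (restrict g (lucas_orbit n), \<lambda>l \<in> {1..n}. \<lambda>m \<in> {3..n - 2}. restrict g (fib_orbit n m l))"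

lemma rule201_in_BijGroup:
  assumes "n > 3"
  shows "rule201 n i \<in> carrier (BijGroup (states n))"
proof -
  let ?F = "rule201 n i"
  have n0: "n > 0" using assms by simp
  have ne1: "(i + n - 1) mod n \<noteq> i mod n"
  proof
    assume "(i + n - 1) mod n = i mod n"
    then have "n dvd (i + n - 1) - i" using n0 by (subst (asm) mod_eq_dvd_iff_nat) auto
    then show False using assms by (simp add: nat_dvd_not_less)
  qed
  have ne2: "(i + 1) mod n \<noteq> i mod n"
  proof
    assume "(i + 1) mod n = i mod n"
    then have "n dvd (i + 1) - i" by (subst (asm) mod_eq_dvd_iff_nat) auto
    then show False using assms by simp
  qed
  have mem: "?F y \<in> states n" if "y \<in> states n" for y
    using that n0 by (auto simp: rule201_def states_def PiE_iff extensional_def)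
  have inv: "?F (?F y) = y" if "y \<in> states n" for y
    using that mem[OF that] ne1 ne2
    by (auto simp: rule201_def fun_eq_iff split: if_splits)
  have "bij_betw ?F (states n) (states n)"
    by (rule bij_betwI[where g = ?F]) (auto simp: mem inv)
  moreover have "?F \<in> extensional (states n)" by (simp add: rule201_def)
  ultimately show ?thesis by (simp add: BijGroup_def Bij_def)
qed

lemma group_G201: "group (G201 n)"
  by (simp add: G201_def group.group_subgroup_generated group_BijGroup)

end

theory Submission
  imports Defs
begin

text \<open>
  A coordinate can only be flipped while both of its neighbours are \<open>0\<close>. Hence two cyclically
  adjacent ones protect each other forever, and they also freeze the positions next to them. A state
  is thus cut into blocks: between two consecutive runs of at least two ones lies a stretch that
  starts and ends with a \<open>0\<close> and whose ones are all isolated. What happens inside a block depends only on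
  the block (\<open>isolate_block_G201\<close>), because its first and last coordinates are frozen and hence
  carry no information across the boundary.

  Restricting a group of permutations to an invariant set is always a homomorphism onto the group
  induced there, so the surjectivity of the projections is automatic and the content of the theorem
  is that the chosen orbits determine an element \<open>g\<close> (\<open>G201_eqI\<close>), that is, that they determine
  each coordinate of each \<open>g y\<close>.

  \<^item> If \<open>y\<close> has no adjacent ones, all of its ones can be cleared one at a time, so \<open>y\<close> lies in the
    orbit of the zero state (\<open>lucas_orbitI\<close>).
  \<^item> If \<open>y\<close> has adjacent ones and the coordinate belongs to such a pair or is next to one, every
    group element leaves it unchanged (\<open>G201_frozen_near_adjacent_ones\<close>).
  \<^item> Otherwise the coordinate lies in a block of some length \<open>m\<close> (\<open>surrounding_block\<close>). Being at
    distance at least two from every pair it forces \<open>3 \<le> m\<close>, and the pair outside the block forces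
    \<open>m \<le> n - 2\<close>. Replacing everything outside the block by ones yields a state on which \<open>g\<close> acts
    inside the block as it does on \<open>y\<close>, and clearing the isolated ones shows that this state is in
    the orbit of the corresponding block state (\<open>isolate_block_fib_orbit\<close>).
\<close>

section \<open>Restricting a permutation group to an orbit\<close>

text \<open>
  On the orbit the map of the inverse element inverts the map of a group element, which gives
  bijectivity also when the orbit is infinite.
\<close>

lemma (in group_action) restrict_to_orbit:
  assumes x: "x \<in> E"
  defines "A \<equiv> orbit G \<phi> x"
  shows "group_action G A (\<lambda>g. restrict (\<phi> g) A)"
proof -
  interpret group_hom G "BijGroup E" \<phi> by (rule group_hom)
  have AE: "A \<subseteq> E" using x element_image by (auto simp: A_def orbit_def)
  have maps: "\<phi> g a \<in> A" if "g \<in> carrier G" "a \<in> A" for g a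
    using that x unfolding A_def orbit_def by clarsimp (metis composition_rule G.m_closed)
  have inv1: "\<phi> (inv g) (\<phi> g a) = a" if "g \<in> carrier G" "a \<in> A" for g a
    using orbit_sym_aux that AE by blast
  have inv2: "\<phi> g (\<phi> (inv g) a) = a" if "g \<in> carrier G" "a \<in> A" for g a
    using inv1[of "inv g" a] that by simp
  have Bij: "restrict (\<phi> g) A \<in> Bij A" if "g \<in> carrier G" for g
  proof -
    have "bij_betw (\<phi> g) A A"
      by (rule bij_betw_byWitness[where f' = "\<phi> (inv g)"]) (use that in \<open>auto simp: inv1 inv2 maps simp del: hom_inv\<close>)
    then show ?thesis by (simp add: Bij_def)
  qed
  have "(\<lambda>g. restrict (\<phi> g) A) \<in> hom G (BijGroup A)"
  proof (rule homI)
    fix g h assume gh: "g \<in> carrier G" "h \<in> carrier G"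
    have "restrict (\<phi> (g \<otimes> h)) A = compose A (restrict (\<phi> g) A) (restrict (\<phi> h) A)"
      using gh AE maps by (auto simp: fun_eq_iff compose_def composition_rule simp del: hom_mult)
    then show "restrict (\<phi> (g \<otimes> h)) A = restrict (\<phi> g) A \<otimes>\<^bsub>BijGroup A\<^esub> restrict (\<phi> h) A"
      using gh by (simp add: BijGroup_def Bij)
  qed (simp add: BijGroup_def Bij)
  then show ?thesis
    by (simp add: group_action_def group_hom_def group_hom_axioms_def group_BijGroup G.is_group)
qed

lemma group_action_G201: "group_action (G201 n) (states n) (\<lambda>g. g)"
proof -
  have "carrier (G201 n) \<subseteq> carrier (BijGroup (states n))"
    unfolding G201_def by (rule group.carrier_subgroup_generated_subset[OF group_BijGroup])
  then have "(\<lambda>g. g) \<in> hom (G201 n) (BijGroup (states n))"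
    by (auto simp: hom_def G201_def subgroup_generated_def)
  then show ?thesis
    by (simp add: group_action_def group_hom_def group_hom_axioms_def group_BijGroup group_G201)
qed

lemma restriction_group_orbit:
  assumes "x \<in> states n"
  defines "A \<equiv> orbit201 n x"
  shows "group (restriction_group (G201 n) A)"
    and "(\<lambda>g. restrict g A) \<in> hom (G201 n) (restriction_group (G201 n) A)"
proof -
  interpret group_action "G201 n" A "\<lambda>g. restrict g A"
    using group_action.restrict_to_orbit[OF group_action_G201 assms(1)]
    by (simp add: A_def orbit201_def)
  interpret group_hom "G201 n" "BijGroup A" "\<lambda>g. restrict g A"
    by (rule group_hom)
  show "group (restriction_group (G201 n) A)"
    unfolding restriction_group_def
    by (rule subgroup.subgroup_is_group[OF img_is_subgroup group_BijGroup])
  show "(\<lambda>g. restrict g A) \<in> hom (G201 n) (restriction_group (G201 n) A)"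
    using homh by (auto simp: hom_def restriction_group_def)
qed

text \<open>
  A product carries only functions extensional on the index set, so besides the coordinate maps
  being homomorphisms the values have to be normalised outside that set.
\<close>

lemma hom_product_groupI:
  assumes "\<And>g. g \<in> carrier G \<Longrightarrow> f g \<in> extensional I"
    and "\<And>i. i \<in> I \<Longrightarrow> (\<lambda>g. f g i) \<in> hom G (H i)"
    and "group G"
  shows "f \<in> hom G (product_group I H)"
proof (rule homI)
  show "f g \<in> carrier (product_group I H)" if "g \<in> carrier G" for g
    using assms(1) hom_in_carrier[OF assms(2)] that by (simp add: PiE_iff)
  fix g h assume gh: "g \<in> carrier G" "h \<in> carrier G"
  then have "g \<otimes>\<^bsub>G\<^esub> h \<in> carrier G" using assms(3) by (simp add: group.is_monoid monoid.m_closed)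
  then show "f (g \<otimes>\<^bsub>G\<^esub> h) = f g \<otimes>\<^bsub>product_group I H\<^esub> f h"
    using assms(1) hom_mult[OF assms(2)] gh by (intro extensionalityI[of _ I]) auto
qed

section \<open>Positions on the cycle\<close>

lemma offset_mod_eq_iff:
  fixes l :: nat
  assumes "k < n" "k' < n"
  shows "(l + k) mod n = (l + k') mod n \<longleftrightarrow> k = k'"
proof
  assume eq: "(l + k) mod n = (l + k') mod n"
  have le: "j' \<le> j" if "(l + j) mod n = (l + j') mod n" "j' < n" for j j'
  proof (rule ccontr)
    assume "\<not> j' \<le> j"
    then have "n dvd j' - j" using that mod_eq_dvd_iff_nat[of "l + j" "l + j'" n] by simp
    then show False using \<open>\<not> j' \<le> j\<close> \<open>j' < n\<close> by (auto dest: dvd_imp_le)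
  qed
  show "k = k'" using le[of k k'] le[of k' k] eq assms by simp
qed simp

lemma offset_exists:
  fixes l :: nat
  assumes "j < n"
  shows "\<exists>k<n. j = (l + k) mod n"
proof -
  have "(l + (j + (n - l mod n)) mod n) mod n = (l + (j + (n - l mod n))) mod n"
    by (simp add: mod_add_right_eq)
  also have "\<dots> = (l mod n + (j + (n - l mod n))) mod n" by (simp add: mod_add_left_eq)
  also have "l mod n + (j + (n - l mod n)) = j + n"
    using mod_less_divisor[of n l] assms by linarith
  also have "(j + n) mod n = j" using assms by simp
  finally show ?thesis using assms by (intro exI[of _ "(j + (n - l mod n)) mod n"]) auto
qed

lemma pred_mod_cong:
  fixes n :: nat
  assumes "i mod n = j mod n"
  shows "(i + n - 1) mod n = (j + n - 1) mod n"
proof (cases "n = 0")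
  case False
  then have "i + n - 1 = i + (n - 1)" "j + n - 1 = j + (n - 1)" by auto
  then show ?thesis using assms by (metis mod_add_left_eq)
qed (use assms in simp)

section \<open>Local updates\<close>

lemma rule201_states:
  assumes "n > 3" "y \<in> states n"
  shows "rule201 n i y \<in> states n"
  using rule201_in_BijGroup[OF assms(1), of i] assms(2)
  by (auto simp: BijGroup_def dest: Bij_imp_funcset)

lemma rule201_other:
  assumes "y \<in> states n" "p \<noteq> i mod n"
  shows "rule201 n i y p = y p"
  using assms by (simp add: rule201_def)

text \<open>
  A one blocks its neighbours. Everything about frozen coordinates below comes from this.
\<close>

lemma rule201_stable:
  assumes "y \<in> states n" "y ((j + 1) mod n) = 1 \<or> y ((j + n - 1) mod n) = 1"
  shows "rule201 n i y (j mod n) = y (j mod n)"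
proof (cases "j mod n = i mod n")
  case True
  have "(j + 1) mod n = (i + 1) mod n"
    using True by (metis mod_add_left_eq)
  moreover have "(j + n - 1) mod n = (i + n - 1) mod n"
    using True by (rule pred_mod_cong)
  ultimately show ?thesis using assms by (auto simp: rule201_def)
qed (use assms in \<open>simp add: rule201_other\<close>)

lemma rule201_involution:
  assumes "n > 3" "y \<in> states n"
  shows "rule201 n i (rule201 n i y) = y"
proof -
  have ne: "(i + n - 1) mod n \<noteq> i mod n" "(i + 1) mod n \<noteq> i mod n"
    using assms(1) offset_mod_eq_iff[of "n - 1" n 0 i] offset_mod_eq_iff[of 1 n 0 i] by auto
  show ?thesis
    using assms(2) rule201_states[OF assms, of i] ne
    by (auto simp: rule201_def fun_eq_iff split: if_splits)
qed

text \<open>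
  The generators are involutions, so every element is a composition of generators and inverses need
  no case of their own.
\<close>

lemma G201_induct [consumes 2, case_names one rule mult]:
  assumes n: "n > 3" and g: "g \<in> carrier (G201 n)"
    and one: "P (\<lambda>y \<in> states n. y)"
    and rule: "\<And>i. P (rule201 n i)"
    and mult: "\<And>g h. g \<in> carrier (G201 n) \<Longrightarrow> h \<in> carrier (G201 n) \<Longrightarrow> P g \<Longrightarrow> P h \<Longrightarrow>
      P (compose (states n) g h)"
  shows "P g"
proof -
  let ?B = "BijGroup (states n)"
  interpret B: group ?B by (rule group_BijGroup)
  let ?S = "carrier ?B \<inter> rule201 n ` {1..n}"
  have G: "carrier (G201 n) = generate ?B ?S"
    by (simp add: G201_def carrier_subgroup_generated)
  have sub: "generate ?B ?S \<subseteq> Bij (states n)"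
    using B.generate_incl[of ?S] by (auto simp: BijGroup_def)
  from g have "g \<in> generate ?B ?S" by (simp only: G)
  then show ?thesis
  proof induction
    case one
    have "\<one>\<^bsub>?B\<^esub> = (\<lambda>y \<in> states n. y)" by (simp add: BijGroup_def)
    then show ?case using assms(3) by (simp only:)
  next
    case (incl h)
    then show ?case using rule by blast
  next
    case (inv h)
    then obtain i where h: "h = rule201 n i" by blast
    have hB: "h \<in> Bij (states n)" using inv by (simp add: BijGroup_def)
    have "compose (states n) h h = (\<lambda>y \<in> states n. y)"
      using rule201_involution[OF n] by (auto simp: compose_def h fun_eq_iff)
    then have "h \<otimes>\<^bsub>?B\<^esub> h = \<one>\<^bsub>?B\<^esub>" using hB by (simp add: BijGroup_def)
    then have "inv\<^bsub>?B\<^esub> h = h" using inv by (intro B.inv_equality) auto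
    then show ?case using rule h by simp
  next
    case (eng h1 h2)
    have "h1 \<otimes>\<^bsub>?B\<^esub> h2 = compose (states n) h1 h2"
      using eng sub by (auto simp: BijGroup_def)
    then show ?case using mult[of h1 h2] eng by (simp add: G)
  qed
qed

lemma G201_states:
  assumes "g \<in> carrier (G201 n)" "y \<in> states n"
  shows "g y \<in> states n"
  using group_action.element_image[OF group_action_G201 assms] by simp

section \<open>Adjacent ones are frozen\<close>

definition adjacent_ones :: "nat \<Rightarrow> (nat \<Rightarrow> bit) \<Rightarrow> nat \<Rightarrow> bool" where
  "adjacent_ones n y k \<longleftrightarrow> y (k mod n) = 1 \<and> y ((k + 1) mod n) = 1"

lemma adjacent_ones_add_self [simp]: "adjacent_ones n y (k + n) = adjacent_ones n y k"
proof -
  have "k + n + 1 = k + 1 + n" by simp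
  then show ?thesis unfolding adjacent_ones_def by (metis mod_add_self2)
qed

lemma rule201_adjacent_ones:
  assumes "y \<in> states n" "adjacent_ones n y k"
  shows "adjacent_ones n (rule201 n i y) k"
  using assms rule201_stable[of y n k i] rule201_stable[of y n "k + 1" i]
  by (simp add: adjacent_ones_def)

lemma G201_adjacent_ones:
  assumes "n > 3" "g \<in> carrier (G201 n)" "y \<in> states n" "adjacent_ones n y k"
  shows "adjacent_ones n (g y) k"
  using assms(1,2,3,4)
proof (induction arbitrary: y rule: G201_induct)
  case (mult g h)
  then show ?case by (simp add: compose_def G201_states)
qed (auto simp: rule201_adjacent_ones)

text \<open>
  With ones at \<open>k + 1\<close> and \<open>k + 2\<close>, each of the four positions \<open>k, \<dots>, k + 3\<close> has a neighbour that
  stays \<open>1\<close>. The shift by one avoids the predecessor of \<open>k\<close>, which natural numbers would truncate.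
\<close>

lemma G201_frozen_near_adjacent_ones:
  assumes "n > 3" "g \<in> carrier (G201 n)" "y \<in> states n" "adjacent_ones n y (k + 1)"
    and "j \<in> {k..k + 3}"
  shows "g y (j mod n) = y (j mod n)"
  using assms(1,2,3,4)
proof (induction arbitrary: y rule: G201_induct)
  case (rule i)
  have ones: "y ((k + 1) mod n) = 1" "y ((k + 2) mod n) = 1"
    using rule(2) by (simp_all add: adjacent_ones_def)
  consider "j = k" | "j = k + 1" | "j = (k + 1) + 1" | "j = (k + 2) + 1"
    using assms(5) by fastforce
  then have "y ((j + 1) mod n) = 1 \<or> y ((j + n - 1) mod n) = 1"
  proof cases
    case 3
    then have "j + n - 1 = k + 1 + n" by simp
    then show ?thesis using ones(1) by (metis mod_add_self2)
  next
    case 4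
    then have "j + n - 1 = k + 2 + n" by simp
    then show ?thesis using ones(2) by (metis mod_add_self2)
  qed (use ones in simp_all)
  then show ?case using rule(1) by (rule rule201_stable[rotated])
next
  case (mult g h)
  then show ?case by (simp add: compose_def G201_states G201_adjacent_ones[OF assms(1)])
qed auto

section \<open>Clearing isolated ones\<close>

text \<open>
  The hypothesis makes \<open>w\<close> arise from \<open>z\<close> by replacing some isolated ones by zeros. Each of these ones
  can be cleared by a single generator, and since clearing creates no new one, the others stay
  isolated. This one lemma gives membership in both the Lucas and the Fibonacci orbits.
\<close>

lemma clear_isolated_ones:
  assumes n: "n > 3" and "z \<in> states n" "w \<in> states n"
    and "\<And>j. z (j mod n) \<noteq> w (j mod n) \<Longrightarrow>
      w (j mod n) = 0 \<and> z ((j + 1) mod n) = 0 \<and> z ((j + n - 1) mod n) = 0"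
  shows "z \<in> orbit201 n w"
  using assms(2,4)
proof (induction "card {j. j < n \<and> z j \<noteq> w j}" arbitrary: z rule: less_induct)
  case (less z)
  interpret group_action "G201 n" "states n" "\<lambda>g. g" by (rule group_action_G201)
  show ?case
  proof (cases "\<exists>j<n. z j \<noteq> w j")
    case False
    then have "z = w"
      using less(2) assms(3) by (intro PiE_ext) (auto simp: states_def)
    then show ?thesis using orbit_refl assms(3) by (simp add: orbit201_def)
  next
    case True
    then obtain j where j: "j < n" "z j \<noteq> w j" by blast
    from less(3)[of j] j have zj: "w j = 0" "z j = 1" "z ((j + 1) mod n) = 0" "z ((j + n - 1) mod n) = 0"
      by auto
    \<comment> \<open>The generators are indexed by \<open>{1..n}\<close>, where \<open>n\<close> stands for the coordinate \<open>0\<close>.\<close>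
    define i where "i = (if j = 0 then n else j)"
    have i: "i \<in> {1..n} \<and> i mod n = j \<and> (i + 1) mod n = (j + 1) mod n \<and>
      (i + n - 1) mod n = (j + n - 1) mod n"
    proof (cases "j = 0")
      case True
      then have "i + n - 1 = (n - 1) + n" using n by (simp add: i_def)
      then have "(i + n - 1) mod n = (n - 1) mod n" by (metis mod_add_self2)
      moreover have "(n + 1) mod n = 1" using n by (simp add: mod_Suc)
      ultimately show ?thesis using True n by (simp add: i_def)
    qed (use j in \<open>simp add: i_def\<close>)
    let ?z = "z(j := 0)"
    have F: "rule201 n i z = ?z"
      using less(2) zj i by (simp add: rule201_def)
    have zs: "?z \<in> states n" using F rule201_states[OF n less(2), of i] by simp
    have "{k. k < n \<and> ?z k \<noteq> w k} = {k. k < n \<and> z k \<noteq> w k} - {j}"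
      using zj(1) by (auto split: if_splits)
    then have "card {k. k < n \<and> ?z k \<noteq> w k} < card {k. k < n \<and> z k \<noteq> w k}"
      using j by (simp only:) (rule card_Diff1_less, auto)
    moreover have "w (k mod n) = 0 \<and> ?z ((k + 1) mod n) = 0 \<and> ?z ((k + n - 1) mod n) = 0"
      if "?z (k mod n) \<noteq> w (k mod n)" for k
      using that less(3)[of k] zj by (auto split: if_splits)
    ultimately have "?z \<in> orbit201 n w" using less(1) zs by blast
    moreover have "rule201 n i \<in> carrier (G201 n)"
      unfolding G201_def carrier_subgroup_generated
      using i rule201_in_BijGroup[OF n] by (intro generate.incl) auto
    then have "?z \<in> orbit201 n z"
      using F unfolding orbit201_def orbit_def by (auto intro!: exI[of _ "rule201 n i"])
    ultimately show ?thesis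
      using orbit_trans[OF assms(3) zs less(2)] orbit_sym[OF less(2) zs]
      by (simp add: orbit201_def)
  qed
qed

lemma zero_state_states [simp]: "zero_state n \<in> states n"
  by (simp add: zero_state_def states_def)

lemma block_state_states [simp]: "block_state n m l \<in> states n"
  by (simp add: block_state_def states_def)

lemma lucas_orbitI:
  assumes n: "n > 3" and y: "y \<in> states n" and none: "\<And>k. \<not> adjacent_ones n y k"
  shows "y \<in> lucas_orbit n"
  unfolding lucas_orbit_def
proof (rule clear_isolated_ones[OF n y zero_state_states])
  fix j assume "y (j mod n) \<noteq> zero_state n (j mod n)"
  moreover have "zero_state n (j mod n) = 0" using n by (simp add: zero_state_def)
  ultimately show "zero_state n (j mod n) = 0 \<and> y ((j + 1) mod n) = 0 \<and> y ((j + n - 1) mod n) = 0"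
    using none[of j] none[of "j + n - 1"] n by (simp add: adjacent_ones_def)
qed

section \<open>The dynamics inside one block\<close>

definition isolate_block :: "nat \<Rightarrow> nat \<Rightarrow> nat \<Rightarrow> (nat \<Rightarrow> bit) \<Rightarrow> (nat \<Rightarrow> bit)" where
  "isolate_block n m l y = (\<lambda>j \<in> {..<n}. if \<exists>k<m. j = (l + k) mod n then y j else 1)"

lemma isolate_block_offset:
  assumes "m \<le> n" "k < n"
  shows "isolate_block n m l y ((l + k) mod n) = (if k < m then y ((l + k) mod n) else 1)"
  using assms by (auto simp: isolate_block_def offset_mod_eq_iff)

lemma isolate_block_states [simp]: "isolate_block n m l y \<in> states n"
  by (simp add: isolate_block_def states_def)

lemma states_offset_eqI:
  assumes "y \<in> states n" "z \<in> states n" "\<And>k. k < n \<Longrightarrow> y ((l + k) mod n) = z ((l + k) mod n)"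
  shows "y = z"
proof (rule PiE_ext)
  fix j assume "j \<in> {..<n}"
  then show "y j = z j" using offset_exists[of j n l] assms(3) by auto
qed (use assms in \<open>auto simp: states_def\<close>)


text \<open>
  The positions \<open>l + m\<close>, \<open>l + m + 1\<close> and \<open>l + (n - 2)\<close>, \<open>l + (n - 1)\<close>, the latter being \<open>l - 2\<close> and
  \<open>l - 1\<close> modulo \<open>n\<close>, are the two pairs of ones enclosing the block; they coincide if \<open>m = n - 2\<close>. An
  update strictly inside the block sees the same neighbours in both states, an update at an end of
  the block is blocked by the one just outside it, and an update outside does nothing to the isolated
  block: there at least one neighbour is also outside and hence \<open>1\<close>, as at least two positions lie
  outside.
\<close>

lemma isolate_block_rule201:
  assumes n: "n > 3" and m: "3 \<le> m" "m \<le> n - 2" and y: "y \<in> states n"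
    and right: "adjacent_ones n y (l + m)" and left: "adjacent_ones n y (l + (n - 2))"
  shows "rule201 n i (isolate_block n m l y) = isolate_block n m l (rule201 n i y)"
proof -
  let ?z = "isolate_block n m l y"
  obtain k where k: "k < n" "i mod n = (l + k) mod n"
    using offset_exists[of "i mod n" n l] n by auto
  have other: "rule201 n i x ((l + k') mod n) = x ((l + k') mod n)"
    if "x \<in> states n" "k' < n" "k' \<noteq> k" for x k'
    using that k by (simp add: rule201_other offset_mod_eq_iff)
  have succ: "(i + 1) mod n = (l + (k + 1)) mod n"
    using k(2) by (metis add.assoc mod_add_left_eq)
  have pred: "(i + n - 1) mod n = (l + (k + n - 1)) mod n"
    using pred_mod_cong[OF k(2)] n by (simp add: add.assoc)
  have z: "?z ((l + k') mod n) = (if k' < m then y ((l + k') mod n) else 1)" if "k' < n" for k'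
    using isolate_block_offset that m by simp
  have l1: "y ((l + (n - 1)) mod n) = 1"
  proof -
    have "l + (n - 2) + 1 = l + (n - 1)" using n by simp
    then show ?thesis using left unfolding adjacent_ones_def by (simp only:)
  qed
  have at: "rule201 n i x (i mod n) = (if x ((l + (k + n - 1)) mod n) = 0 \<and> x ((l + (k + 1)) mod n) = 0
      then 1 - x (i mod n) else x (i mod n))" if "x \<in> states n" for x
    using that succ pred by (simp add: rule201_def)
  \<comment> \<open>The updated position has offset \<open>k\<close> from the start of the block. The cases are the two ends of
    the block, its interior, and the outside; for the outside the right neighbour serves as the
    blocking one, except at the last offset, whose right neighbour is the start of the block.\<close>
  have here: "rule201 n i ?z ((l + k) mod n) =
      (if k < m then rule201 n i y ((l + k) mod n) else 1)"
  proof -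
    consider "k = 0" | "0 < k" "k < m - 1" | "k = m - 1" | "m \<le> k" "k + 1 < n" | "k = n - 1"
      using k(1) by linarith
    then show ?thesis
    proof cases
      case 1
      then show ?thesis using at[OF y] at[of ?z] k m z[of 0] z[of "n - 1"] l1 by simp
    next
      case 2
      then have p: "(l + (k + n - 1)) mod n = (l + (k - 1)) mod n"
      proof -
        have "l + (k + n - 1) = l + (k - 1) + n" using 2 by simp
        then show ?thesis by (metis mod_add_self2)
      qed
      show ?thesis
        using at[OF y] at[of ?z] k m z[of k] z[of "k - 1"] z[of "k + 1"] 2 unfolding p
        by simp
    next
      case 3
      then have "k + 1 = m" using m by simp
      then show ?thesis
        using at[OF y] at[of ?z] k m z[of k] z[of m] right by (simp add: adjacent_ones_def)
    next
      case 4
      then show ?thesis using at[of ?z] k m z[of k] z[of "k + 1"] by simp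
    next
      case 5
      have p: "(l + (k + n - 1)) mod n = (l + (n - 2)) mod n"
      proof -
        have "l + (k + n - 1) = l + (n - 2) + n" using 5 n by simp
        then show ?thesis by (metis mod_add_self2)
      qed
      have "\<not> k < m" "\<not> n - 2 < m" "n - 2 < n" using 5 m n by auto
      then show ?thesis using at[of ?z] k z[of k] z[of "n - 2"] unfolding p by simp
    qed
  qed
  show ?thesis
  proof (rule states_offset_eqI)
    fix k' assume k': "k' < n"
    show "rule201 n i ?z ((l + k') mod n) = isolate_block n m l (rule201 n i y) ((l + k') mod n)"
      using here other[of ?z k'] other[of y k'] k' y m z[of k']
      by (cases "k' = k") (simp_all add: isolate_block_offset)
  qed (use rule201_states n y in auto)
qed

text \<open>
  The step from generators to the group is possible because the enclosing pairs survive every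
  update, so that the hypotheses still hold for the intermediate states.
\<close>

lemma isolate_block_G201:
  assumes n: "n > 3" and g: "g \<in> carrier (G201 n)" and m: "3 \<le> m" "m \<le> n - 2"
    and y: "y \<in> states n"
    and "adjacent_ones n y (l + m)" "adjacent_ones n y (l + (n - 2))"
  shows "g (isolate_block n m l y) = isolate_block n m l (g y)"
  using n g assms(5-)
proof (induction arbitrary: y rule: G201_induct)
  case (rule i)
  then show ?case using isolate_block_rule201[OF n m] by simp
next
  case (mult g h)
  then show ?case by (simp add: compose_def G201_states G201_adjacent_ones[OF n])
qed simp

lemma block_state_offset:
  assumes "m \<le> n" "k < n"
  shows "block_state n m l ((l + k) mod n) = (if k < m then 0 else 1)"
  using assms by (auto simp: block_state_def offset_mod_eq_iff)

text \<open>
  The isolated block and the block state differ only in ones strictly inside the block, and these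
  ones are isolated, so clearing them leads from one state to the other.
\<close>

lemma isolate_block_fib_orbit:
  assumes n: "n > 3" and m: "3 \<le> m" "m \<le> n - 2"
    and first: "y (l mod n) = 0" and last: "y ((l + (m - 1)) mod n) = 0"
    and none: "\<And>k. k + 1 < m \<Longrightarrow> \<not> adjacent_ones n y (l + k)"
  shows "isolate_block n m l y \<in> fib_orbit n m l"
  unfolding fib_orbit_def
proof (rule clear_isolated_ones[OF n])
  let ?z = "isolate_block n m l y"
  fix j assume differ: "?z (j mod n) \<noteq> block_state n m l (j mod n)"
  have z: "?z ((l + k') mod n) = (if k' < m then y ((l + k') mod n) else 1)" if "k' < n" for k'
    using isolate_block_offset that m by simp
  obtain k where k: "k < n" "j mod n = (l + k) mod n"
    using offset_exists[of "j mod n" n l] n by auto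
  have km: "k < m" and one: "y ((l + k) mod n) = 1"
    using differ k z[of k] block_state_offset[of m n k l] m by (auto split: if_splits)
  have "k \<noteq> 0" "k \<noteq> m - 1" using first last one by (auto intro: ccontr)
  then have k0: "0 < k" "k + 1 < m" using km by auto
  have succ: "(j + 1) mod n = (l + (k + 1)) mod n"
    using k(2) by (metis add.assoc mod_add_left_eq)
  have pred: "(j + n - 1) mod n = (l + (k - 1)) mod n"
  proof -
    have "(j + n - 1) mod n = (l + k + n - 1) mod n" by (rule pred_mod_cong[OF k(2)])
    also have "l + k + n - 1 = l + (k - 1) + n" using k0 n by simp
    finally show ?thesis by simp
  qed
  have "y ((l + (k + 1)) mod n) = 0" "y ((l + (k - 1)) mod n) = 0"
    using none[of k] none[of "k - 1"] k0 one by (auto simp: adjacent_ones_def)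
  then show "block_state n m l (j mod n) = 0 \<and> ?z ((j + 1) mod n) = 0 \<and> ?z ((j + n - 1) mod n) = 0"
    unfolding succ pred k(2)
    using k k0 m z[of "k + 1"] z[of "k - 1"] block_state_offset[of m n k l] by simp
qed simp_all

lemma fib_orbit_mod: "fib_orbit n m (l mod n) = fib_orbit n m l"
proof -
  have "block_state n m (l mod n) = block_state n m l"
    by (simp add: block_state_def mod_add_left_eq)
  then show ?thesis by (simp add: fib_orbit_def)
qed

section \<open>An element is determined by its action on these orbits\<close>

text \<open>
  The block is bounded by the last pair of adjacent ones before the position and the first one after
  it. A single pair suffices, since its translates by multiples of \<open>n\<close> occur on both sides.
\<close>

lemma surrounding_block:
  assumes n: "n > 3" and ex: "adjacent_ones n y k"
    and far: "\<And>k. adjacent_ones n y (k + 1) \<Longrightarrow> \<forall>i \<in> {k..k + 3}. i mod n \<noteq> j mod n"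
  obtains l m d where "3 \<le> m" "m \<le> n - 2" "d < m" "j mod n = (l + d) mod n"
    "adjacent_ones n y (l + m)" "adjacent_ones n y (l + (n - 2))"
    "\<And>i. i + 1 < m \<Longrightarrow> \<not> adjacent_ones n y (l + i)"
    "y (l mod n) = 0" "y ((l + (m - 1)) mod n) = 0"
proof -
  \<comment> \<open>Moving the position two periods up leaves room for the search to the left.\<close>
  define J where "J = j mod n + 2 * n"
  have Jn: "J mod n = j mod n" by (simp add: J_def)
  have periodic: "adjacent_ones n y i \<longleftrightarrow> adjacent_ones n y i'" if "i mod n = i' mod n" for i i'
    using that unfolding adjacent_ones_def by (metis mod_add_left_eq)
  obtain c where c: "c < n" "(J - n + c) mod n = k mod n"
    using offset_exists[of "k mod n" n "J - n"] n by auto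
  \<comment> \<open>\<open>a\<close> and \<open>b\<close> are the left positions of the enclosing pairs, so the block is \<open>{a + 2..<b}\<close>. As \<open>a + n\<close>
    carries a pair too, \<open>b \<le> a + n\<close>, which bounds the length of the block by \<open>n - 2\<close>.\<close>
  define P where "P = (\<lambda>a. a < J \<and> adjacent_ones n y a)"
  have Pc: "P (J - n + c)"
    using c ex periodic[OF c(2)] by (auto simp: P_def J_def)
  have bound: "\<And>a. P a \<Longrightarrow> a \<le> J" by (simp add: P_def)
  define a where "a = (GREATEST a. P a)"
  have Pa: "P a" unfolding a_def using GreatestI_nat[of P, OF Pc] bound by blast
  have a_max: "a' \<le> a" if "P a'" for a'
    unfolding a_def using Greatest_le_nat[of P, OF that] bound by blast
  define Q where "Q = (\<lambda>b. J \<le> b \<and> adjacent_ones n y b)"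
  have aJ: "J - n \<le> a" using a_max[OF Pc] by simp
  have Qa: "Q (a + n)" using Pa aJ by (auto simp: P_def Q_def J_def)
  define b where "b = (LEAST b. Q b)"
  have Qb: "Q b" unfolding b_def by (rule LeastI[of Q, OF Qa])
  have b_min: "b \<le> b'" if "Q b'" for b' unfolding b_def by (rule Least_le[of Q, OF that])
  have none: "\<not> adjacent_ones n y i" if "a < i" "i < b" for i
    using that a_max[of i] b_min[of i] by (fastforce simp: P_def Q_def)
  have dist: "\<not> (c \<le> J \<and> J \<le> c + 3)" if "adjacent_ones n y (c + 1)" for c
    using far[OF that] Jn by auto
  have "a \<noteq> 0" using aJ n by (auto simp: J_def)
  have a3: "a + 3 \<le> J"
    using dist[of "a - 1"] \<open>a \<noteq> 0\<close> Pa by (auto simp: P_def)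
  have b2: "J + 2 \<le> b"
    using dist[of "b - 1"] Qb n by (auto simp: Q_def J_def)
  have ba: "b \<le> a + n" by (rule b_min[OF Qa])
  let ?l = "a + 2" and ?m = "b - (a + 2)"
  show thesis
  proof (rule that[of ?m "J - ?l" ?l])
    have "?l + (J - ?l) = J" using a3 by simp
    then show "j mod n = (?l + (J - ?l)) mod n" by (simp only: Jn)
    have "?l + ?m = b" using a3 b2 by simp
    then show "adjacent_ones n y (?l + ?m)" using Qb by (simp only: Q_def)
    have "?l + (n - 2) = a + n" using n by simp
    then show "adjacent_ones n y (?l + (n - 2))" using Pa by (simp only: adjacent_ones_add_self P_def)
    show "\<not> adjacent_ones n y (?l + i)" if "i + 1 < ?m" for i
      using that by (intro none) auto
    have "\<not> adjacent_ones n y (a + 1)" using none a3 b2 by simp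
    then show "y (?l mod n) = 0" using Pa by (auto simp: adjacent_ones_def P_def)
    have b1: "\<not> adjacent_ones n y (b - 1)" "b - 1 + 1 = b" "?l + (?m - 1) = b - 1"
      using none[of "b - 1"] a3 b2 by auto
    have "y ((b - 1) mod n) = 0"
      using Qb b1(1) unfolding adjacent_ones_def Q_def b1(2) by auto
    then show "y ((?l + (?m - 1)) mod n) = 0" by (simp only: b1(3))
  qed (use a3 b2 ba in auto)
qed

text \<open>
  Every coordinate of every state is either frozen, or its evolution can be read off from a state in
  one of these orbits.
\<close>

lemma G201_eqI:
  assumes n: "n > 3" and g: "g \<in> carrier (G201 n)" and h: "h \<in> carrier (G201 n)"
    and lucas: "\<And>y. y \<in> lucas_orbit n \<Longrightarrow> g y = h y"
    and fib: "\<And>l m y. l \<in> {1..n} \<Longrightarrow> m \<in> {3..n - 2} \<Longrightarrow> y \<in> fib_orbit n m l \<Longrightarrow> g y = h y"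
  shows "g = h"
proof -
  \<comment> \<open>The Fibonacci orbits depend on the starting position only modulo \<open>n\<close>.\<close>
  have fib': "g y = h y" if "3 \<le> m" "m \<le> n - 2" "y \<in> fib_orbit n m l" for l m y
  proof -
    define l' where "l' = (if l mod n = 0 then n else l mod n)"
    have "l' mod n = l mod n" by (simp add: l'_def)
    then have "y \<in> fib_orbit n m l'" using that(3) fib_orbit_mod by metis
    moreover have "l' \<in> {1..n}" using n by (simp add: l'_def Suc_le_eq less_imp_le)
    ultimately show ?thesis using fib that by simp
  qed
  have agree: "g y (j mod n) = h y (j mod n)" if y: "y \<in> states n" for y j
  proof (cases "\<exists>k. adjacent_ones n y k")
    case False
    then show ?thesis using lucas lucas_orbitI[OF n y] by simp
  next
    case True
    then obtain k where k: "adjacent_ones n y k" by blast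
    show ?thesis
    proof (cases "\<exists>k. adjacent_ones n y (k + 1) \<and> (\<exists>i \<in> {k..k + 3}. i mod n = j mod n)")
      case True
      then obtain k i where "adjacent_ones n y (k + 1)" "i \<in> {k..k + 3}" "i mod n = j mod n"
        by blast
      then show ?thesis
        using G201_frozen_near_adjacent_ones[OF n g y, of k i]
          G201_frozen_near_adjacent_ones[OF n h y, of k i] by simp
    next
      case False
      then have far: "\<And>k. adjacent_ones n y (k + 1) \<Longrightarrow> \<forall>i \<in> {k..k + 3}. i mod n \<noteq> j mod n"
        by blast
      obtain l m d where
        m: "3 \<le> m" "m \<le> n - 2" and d: "d < m" "j mod n = (l + d) mod n"
        and adj: "adjacent_ones n y (l + m)" "adjacent_ones n y (l + (n - 2))"
        and none: "\<And>i. i + 1 < m \<Longrightarrow> \<not> adjacent_ones n y (l + i)"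
        and ends: "y (l mod n) = 0" "y ((l + (m - 1)) mod n) = 0"
        by (rule surrounding_block[OF n k], erule far, rule that)
      have "isolate_block n m l (g y) = isolate_block n m l (h y)"
        using fib'[OF m isolate_block_fib_orbit[OF n m ends none]]
          isolate_block_G201[OF n g m y adj] isolate_block_G201[OF n h m y adj] by simp
      from fun_cong[OF this, of "(l + d) mod n"] show ?thesis
        using isolate_block_offset[of m n d l] d m by simp
    qed
  qed
  have eq: "g y = h y" if "y \<in> states n" for y
    by (rule states_offset_eqI[OF G201_states[OF g that] G201_states[OF h that]])
      (rule agree[OF that])
  have "g \<in> extensional (states n)" "h \<in> extensional (states n)"
    using group_action.bij_prop0[OF group_action_G201] g h by (auto dest: Bij_imp_extensional)
  then show "g = h" using eq by (rule extensionalityI)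
qed

theorem theorem5p9:
  fixes n :: nat
  assumes "n > 3"
  shows "subdirect_product (G201 n) (factor_index n) (factor_group n) \<and>
    orbit_restrictions n \<in> mon (G201 n)
      (LG n \<times>\<times> product_group {1..n} (\<lambda>l. product_group {3..n - 2} (\<lambda>m. FG n m l))) \<and>
    (\<lambda>g. fst (orbit_restrictions n g)) ` carrier (G201 n) = carrier (LG n) \<and>
    (\<forall>l\<in>{1..n}. \<forall>m\<in>{3..n - 2}.
      (\<lambda>g. snd (orbit_restrictions n g) l m) ` carrier (G201 n) = carrier (FG n m l))"
proof -
  let ?G = "G201 n"
  have LG: "group (LG n)" "(\<lambda>g. restrict g (lucas_orbit n)) \<in> hom ?G (LG n)"
    using restriction_group_orbit[of "zero_state n" n] by (simp_all add: LG_def lucas_orbit_def)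
  have FG: "group (FG n m l)" "(\<lambda>g. restrict g (fib_orbit n m l)) \<in> hom ?G (FG n m l)" for m l
    using restriction_group_orbit[of "block_state n m l" n] by (simp_all add: FG_def fib_orbit_def)
  have LG_onto: "(\<lambda>g. restrict g (lucas_orbit n)) ` carrier ?G = carrier (LG n)"
    by (simp add: LG_def restriction_group_def)
  have FG_onto: "(\<lambda>g. restrict g (fib_orbit n m l)) ` carrier ?G = carrier (FG n m l)" for m l
    by (simp add: FG_def restriction_group_def)
  have inj: "g = h"
    if "g \<in> carrier ?G" "h \<in> carrier ?G" "restrict g (lucas_orbit n) = restrict h (lucas_orbit n)"
      "\<And>l m. l \<in> {1..n} \<Longrightarrow> m \<in> {3..n - 2} \<Longrightarrow>
        restrict g (fib_orbit n m l) = restrict h (fib_orbit n m l)" for g h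
    using that by (intro G201_eqI[OF assms]) (metis restrict_apply')+
  define \<phi> where "\<phi> = (\<lambda>g :: (nat \<Rightarrow> bit) \<Rightarrow> (nat \<Rightarrow> bit). \<lambda>x \<in> factor_index n.
    restrict g (case_option (lucas_orbit n) (\<lambda>(l, m). fib_orbit n m l) x))"
  have \<phi>_onto: "(\<lambda>g. \<phi> g x) ` carrier ?G = carrier (factor_group n x)" if "x \<in> factor_index n" for x
    using that LG_onto FG_onto by (auto simp: \<phi>_def factor_group_def split: option.split)
  have \<phi>_hom: "(\<lambda>g. \<phi> g x) \<in> hom ?G (factor_group n x)" if "x \<in> factor_index n" for x
    using that LG(2) FG(2) by (auto simp: \<phi>_def factor_group_def split: option.split)
  have "\<phi> \<in> hom ?G (product_group (factor_index n) (factor_group n))"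
    by (rule hom_product_groupI[OF _ \<phi>_hom group_G201]) (simp add: \<phi>_def extensional_def)
  moreover have "inj_on \<phi> (carrier ?G)"
  proof (rule inj_onI)
    fix g h assume gh: "g \<in> carrier ?G" "h \<in> carrier ?G" and eq: "\<phi> g = \<phi> h"
    show "g = h"
    proof (rule inj[OF gh])
      show "restrict g (lucas_orbit n) = restrict h (lucas_orbit n)"
        using fun_cong[OF eq, of None] by (simp add: \<phi>_def factor_index_def)
      show "restrict g (fib_orbit n m l) = restrict h (fib_orbit n m l)"
        if "l \<in> {1..n}" "m \<in> {3..n - 2}" for l m
        using fun_cong[OF eq, of "Some (l, m)"] that by (simp add: \<phi>_def factor_index_def)
    qed
  qed
  moreover have "group (factor_group n x)" for x
    using LG FG by (auto simp: factor_group_def split: option.split)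
  ultimately have 1: "subdirect_product ?G (factor_index n) (factor_group n)"
    using \<phi>_onto unfolding subdirect_product_def mon_def
    by (intro conjI ballI bexI[of _ \<phi>]) (auto simp: group_G201)
  have "orbit_restrictions n \<in> hom ?G
      (LG n \<times>\<times> product_group {1..n} (\<lambda>l. product_group {3..n - 2} (\<lambda>m. FG n m l)))"
    unfolding orbit_restrictions_def hom_paired
    using LG(2) FG(2) by (intro conjI hom_product_groupI group_G201) simp_all
  moreover have "inj_on (orbit_restrictions n) (carrier ?G)"
  proof (rule inj_onI)
    fix g h assume gh: "g \<in> carrier ?G" "h \<in> carrier ?G"
      and eq: "orbit_restrictions n g = orbit_restrictions n h"
    show "g = h"
    proof (rule inj[OF gh])
      show "restrict g (lucas_orbit n) = restrict h (lucas_orbit n)"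
        using eq by (simp add: orbit_restrictions_def)
      show "restrict g (fib_orbit n m l) = restrict h (fib_orbit n m l)"
        if "l \<in> {1..n}" "m \<in> {3..n - 2}" for l m
        using fun_cong[OF fun_cong[OF arg_cong[OF eq, of snd], of l], of m] that
        by (simp add: orbit_restrictions_def)
    qed
  qed
  ultimately have "orbit_restrictions n \<in> mon ?G
      (LG n \<times>\<times> product_group {1..n} (\<lambda>l. product_group {3..n - 2} (\<lambda>m. FG n m l)))"
    by (simp add: mon_def)
  then show ?thesis
    using 1 LG_onto FG_onto by (simp add: orbit_restrictions_def)
qed

end
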